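(* For every integer $k>1$ there exist infinitely many (pairwise non-isomorphic) strongly connected $k$-outregular digraphs that are not semigroup digraphs. Moreover, for every integer $\kappa>0$ with $\left\lfloor \frac{k}{\kappa}\right\rfloor>1$ there are such digraphs (strongly connected, $k$-outregular, not semigroup digraphs) that are strongly $\kappa$-connected and whose underlying undirected graph is $(k+\kappa)$-connected. If $\left\lfloor \frac{k}{\kappa}\right\rfloor>2$, then such digraphs (with all of the preceding properties) exist that cannot even be turned into semigroup digraphs by adding loops, i.e. no digraph obtained from them by adding a set of loops is a semigroup digraph.
   Context: All semigroups and (di)graphs are finite and nonempty. Directed graphs may have loops and anti-parallel arcs but no parallel arcs. For a semigroup $S$ and $C\subseteq S$, $\mathrm{Cay}(S,C)$ is the directed graph with vertex set $S$ and arc set $\{(s,sc)\mid s\in S,\ c\in C\}$. A semigroup digraph is a directed graph isomorphic to $\mathrm{Cay}(S,C)$ for some semigroup $S$ and $C\subseteq S$. A digraph is $k$-outregular if every vertex has outdegree exactly $k$. A digraph is strongly connected if for any two vertices $x,y$ there is a directed path from $x$ to $y$. A subset $V'$ of vertices of a connected graph (resp. strongly connected digraph) $G$ is a vertex cut (resp. directed vertex cut) if $G\setminus V'$ is not connected (resp. not strongly connected). A connected graph (resp. strongly connected digraph) $G$ on $n$ vertices is $\kappa$-connected (resp. strongly $\kappa$-connected) if all its vertex cuts (resp. directed vertex cuts) have size at least $\kappa$ and $\kappa+1\leq n$. *)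

theory Defs
  imports "Graph_Theory.Graph_Theory"
begin

text \<open>Digraphs, possibly with loops and anti-parallel arcs but without parallel arcs, are
  elements of \<^typ>\<open>'a pair_pre_digraph\<close> satisfying \<^const>\<open>pair_fin_digraph\<close>; the injection
  \<^const>\<open>with_proj\<close> into multidigraphs gives access to the general library notions.\<close>

locale fin_semigroup =
  fixes S :: "'a set" and mul :: "'a \<Rightarrow> 'a \<Rightarrow> 'a" (infixl \<open>\<cdot>\<close> 70)
  assumes finite_carrier: "finite S"
    and nonempty_carrier: "S \<noteq> {}"
    and closed: "\<And>a b. a \<in> S \<Longrightarrow> b \<in> S \<Longrightarrow> a \<cdot> b \<in> S"
    and assoc: "\<And>a b c. a \<in> S \<Longrightarrow> b \<in> S \<Longrightarrow> c \<in> S \<Longrightarrow> a \<cdot> b \<cdot> c = a \<cdot> (b \<cdot> c)"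

definition Cay :: "'a set \<Rightarrow> ('a \<Rightarrow> 'a \<Rightarrow> 'a) \<Rightarrow> 'a set \<Rightarrow> 'a pair_pre_digraph" where
  "Cay S mul C = \<lparr> pverts = S, parcs = {(s, mul s c) | s c. s \<in> S \<and> c \<in> C} \<rparr>"

text \<open>A definition cannot quantify over types, so the carrier is taken to be a set of natural
  numbers. This is no restriction: see \<open>semigroup_digraphI\<close> below.\<close>

definition semigroup_digraph :: "'a pair_pre_digraph \<Rightarrow> bool" where
  "semigroup_digraph G \<longleftrightarrow> (\<exists>(S :: nat set) mul C.
     fin_semigroup S mul \<and> C \<subseteq> S \<and> digraph_iso (with_proj G) (with_proj (Cay S mul C)))"

lemma digraph_iso_with_projI:
  assumes "pair_wf_digraph G" "inj_on f (pverts G)" "pverts H = f ` pverts G"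
    "parcs H = map_prod f f ` parcs G"
  shows "digraph_iso (with_proj G) (with_proj H)"
proof -
  interpret pair_wf_digraph G by fact
  define h where "h = \<lparr> iso_verts = f, iso_arcs = map_prod f f, iso_head = snd, iso_tail = fst \<rparr>"
  have "inj_on (map_prod f f) (parcs G)"
  proof (rule inj_onI)
    fix x y assume "x \<in> parcs G" "y \<in> parcs G" "map_prod f f x = map_prod f f y"
    then show "x = y"
      using assms(2) arc_fst_in_verts arc_snd_in_verts
      by (cases x; cases y) (auto dest: inj_onD in_arcsD1 in_arcsD2)
  qed
  moreover have "wf_digraph (with_proj G)" by unfold_locales
  ultimately have "pre_digraph.digraph_isomorphism (with_proj G) h"
    using assms(2) by (auto simp: pre_digraph.digraph_isomorphism_def h_def)
  moreover have "with_proj H = app_iso h (with_proj G)"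
    using assms(3,4) by (simp add: with_proj_def app_iso_def h_def)
  ultimately show ?thesis unfolding digraph_iso_def by blast
qed

lemma semigroup_digraphI:
  fixes S :: "'b set"
  assumes "fin_semigroup S mul" "C \<subseteq> S" "digraph_iso (with_proj G) (with_proj (Cay S mul C))"
  shows "semigroup_digraph G"
proof -
  interpret fin_semigroup S mul by fact
  obtain f :: "'b \<Rightarrow> nat" where f: "inj_on f S"
    using finite_imp_inj_to_nat_seg[OF finite_carrier] by blast
  define g where "g = the_inv_into S f"
  have gf [simp]: "g (f s) = s" if "s \<in> S" for s
    unfolding g_def using the_inv_into_f_f[OF f that] .
  define m where "m a b = f (mul (g a) (g b))" for a b
  have sg: "fin_semigroup (f ` S) m"
    by unfold_locales
      (auto simp: finite_carrier nonempty_carrier m_def closed assoc)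
  have "pair_wf_digraph (Cay S mul C)"
    using assms(2) by unfold_locales (auto simp: Cay_def closed subset_iff)
  moreover have "parcs (Cay (f ` S) m (f ` C)) = map_prod f f ` parcs (Cay S mul C)"
    (is "?L = ?R")
  proof
    show "?L \<subseteq> ?R"
    proof
      fix x assume "x \<in> ?L"
      then obtain s c where *: "s \<in> S" "c \<in> C" "x = (f s, m (f s) (f c))"
        by (auto simp: Cay_def)
      moreover have "c \<in> S" using * assms(2) by blast
      ultimately have "x = map_prod f f (s, mul s c)" by (simp add: m_def)
      moreover have "(s, mul s c) \<in> parcs (Cay S mul C)" using * by (auto simp: Cay_def)
      ultimately show "x \<in> ?R" by (rule image_eqI)
    qed
    show "?R \<subseteq> ?L"
    proof
      fix x assume "x \<in> ?R"
      then obtain s c where *: "s \<in> S" "c \<in> C" "x = (f s, f (mul s c))"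
        by (auto simp: Cay_def)
      moreover have "c \<in> S" using * assms(2) by blast
      ultimately have "x = (f s, m (f s) (f c))" by (simp add: m_def)
      then show "x \<in> ?L" using * by (auto simp: Cay_def)
    qed
  qed
  ultimately have "digraph_iso (with_proj (Cay S mul C)) (with_proj (Cay (f ` S) m (f ` C)))"
    using f by (intro digraph_iso_with_projI) (auto simp: Cay_def)
  with assms(3) have "digraph_iso (with_proj G) (with_proj (Cay (f ` S) m (f ` C)))"
    by (rule digraph_iso_trans)
  then show ?thesis
    unfolding semigroup_digraph_def using sg assms(2) by blast
qed

definition outregular :: "nat \<Rightarrow> ('a,'b) pre_digraph \<Rightarrow> bool" where
  "outregular k G \<longleftrightarrow> (\<forall>v \<in> verts G. out_degree G v = k)"

text \<open>In the library the null graph is neither connected nor strongly connected, so the full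
  vertex set is a (directed) vertex cut below. This does not affect \<open>k_connected\<close> and
  \<open>strongly_k_connected\<close>, which require more than \<open>\<kappa>\<close> vertices.\<close>

definition vertex_cut :: "('a,'b) pre_digraph \<Rightarrow> 'a set \<Rightarrow> bool" where
  "vertex_cut G X \<longleftrightarrow> X \<subseteq> verts G \<and> \<not> Digraph_Component.connected (G \<restriction> (verts G - X))"

definition directed_vertex_cut :: "('a,'b) pre_digraph \<Rightarrow> 'a set \<Rightarrow> bool" where
  "directed_vertex_cut G X \<longleftrightarrow> X \<subseteq> verts G \<and> \<not> strongly_connected (G \<restriction> (verts G - X))"

definition k_connected :: "nat \<Rightarrow> ('a,'b) pre_digraph \<Rightarrow> bool" where
  "k_connected \<kappa> G \<longleftrightarrow> Digraph_Component.connected G \<and>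
     (\<forall>X. vertex_cut G X \<longrightarrow> \<kappa> \<le> card X) \<and> \<kappa> + 1 \<le> card (verts G)"

definition strongly_k_connected :: "nat \<Rightarrow> ('a,'b) pre_digraph \<Rightarrow> bool" where
  "strongly_k_connected \<kappa> G \<longleftrightarrow> strongly_connected G \<and>
     (\<forall>X. directed_vertex_cut G X \<longrightarrow> \<kappa> \<le> card X) \<and> \<kappa> + 1 \<le> card (verts G)"

text \<open>Undirected graphs are symmetric digraphs. Loops of the digraph are kept, which is
  immaterial for connectivity.\<close>

definition underlying_graph :: "'a pair_pre_digraph \<Rightarrow> 'a pair_pre_digraph" where
  "underlying_graph G = mk_symmetric (with_proj G)"

definition add_loops :: "'a set \<Rightarrow> 'a pair_pre_digraph \<Rightarrow> 'a pair_pre_digraph" where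
  "add_loops L G = \<lparr> pverts = pverts G, parcs = parcs G \<union> {(v, v) | v. v \<in> L} \<rparr>"

text \<open>Every finite digraph is isomorphic to one whose vertices are natural numbers, so the
  family may be sought on that vertex type.\<close>

definition infinitely_many_digraphs :: "(nat pair_pre_digraph \<Rightarrow> bool) \<Rightarrow> bool" where
  "infinitely_many_digraphs P \<longleftrightarrow> (\<exists>\<G>. infinite \<G> \<and>
     pairwise (\<lambda>G H. \<not> digraph_iso (with_proj G) (with_proj H)) \<G> \<and>
     (\<forall>G \<in> \<G>. pair_fin_digraph G \<and> pverts G \<noteq> {} \<and> P G))"

end

theory Submission
  imports Defs
begin

text \<open>In a strongly connected \<open>Cay S mul C\<close> every left multiplication is a bijection of \<open>S\<close> that
  preserves arcs, so a vertex carrying the only loop is fixed by all of them; since \<open>v S = S\<close>, the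
  semigroup is then right zero and every vertex carries a loop. It therefore suffices to break the
  symmetry of the circulant digraph on \<open>\<int>/n\<close> with connection set \<open>{1..k}\<close> at a single arc: we
  replace \<open>0 \<rightarrow> k\<close> by a loop at \<open>0\<close>. Bijectivity of left multiplications also makes Cayley
  digraphs outregular, so no further loops can be added. The connectivity is lowered
  by at most one, because a set separating \<open>A\<close> from \<open>B\<close> contains the two disjoint
  gaps in which the cyclic order passes from \<open>A\<close> to \<open>B\<close> and from \<open>B\<close> to \<open>A\<close>.\<close>

section \<open>Connectivity via cuts\<close>

text \<open>Connectivity after deleting vertices is checked through this form: one arc leaving each
  set \<open>A\<close> suffices, and no walk has to be built. For the converse, if \<open>v\<close>
  were unreachable from \<open>u\<close>, the set of vertices reachable from \<open>u\<close> would
  have no leaving arc.\<close>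

lemma (in wf_digraph) strongly_connected_iff_cut:
  "strongly_connected G \<longleftrightarrow> verts G \<noteq> {} \<and>
     (\<forall>A. A \<subset> verts G \<and> A \<noteq> {} \<longrightarrow> (\<exists>a \<in> A. \<exists>b \<in> verts G - A. a \<rightarrow>\<^bsub>G\<^esub> b))"
proof (intro iffI conjI allI impI)
  assume sc: "strongly_connected G"
  then show "verts G \<noteq> {}" by (simp add: strongly_connected_def)
  fix A assume A: "A \<subset> verts G \<and> A \<noteq> {}"
  then obtain u v where uv: "u \<in> A" "v \<in> verts G" "v \<notin> A" by blast
  with A sc have "u \<rightarrow>\<^sup>*\<^bsub>G\<^esub> v" by (auto simp: strongly_connected_def)
  \<comment> \<open>A walk from \<open>u\<close> stays in \<open>A\<close> unless it uses an arc
    that leaves \<open>A\<close>.\<close>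
  then have "v \<in> A \<or> (\<exists>a \<in> A. \<exists>b \<in> verts G - A. a \<rightarrow>\<^bsub>G\<^esub> b)"
    using uv(1) by (induction rule: reachable_induct) (auto dest: adj_in_verts)
  with uv show "\<exists>a \<in> A. \<exists>b \<in> verts G - A. a \<rightarrow>\<^bsub>G\<^esub> b" by blast
next
  assume *: "verts G \<noteq> {} \<and>
     (\<forall>A. A \<subset> verts G \<and> A \<noteq> {} \<longrightarrow> (\<exists>a \<in> A. \<exists>b \<in> verts G - A. a \<rightarrow>\<^bsub>G\<^esub> b))"
  have "u \<rightarrow>\<^sup>*\<^bsub>G\<^esub> v" if uv: "u \<in> verts G" "v \<in> verts G" for u v
  proof (rule ccontr)
    assume nr: "\<not> u \<rightarrow>\<^sup>*\<^bsub>G\<^esub> v"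
    let ?A = "{x \<in> verts G. u \<rightarrow>\<^sup>*\<^bsub>G\<^esub> x}"
    have "?A \<subset> verts G \<and> ?A \<noteq> {}" using uv nr by auto
    with * obtain a b where "u \<rightarrow>\<^sup>*\<^bsub>G\<^esub> a" "b \<in> verts G - ?A" "a \<rightarrow>\<^bsub>G\<^esub> b" by blast
    then show False by (auto dest: reachable_adj_trans)
  qed
  with * show "strongly_connected G" by (simp add: strongly_connected_def)
qed

text \<open>\<open>connected\<close> means strong connectivity of the symmetric closure, so the
  directed criterion applies to that closure.\<close>

lemma (in wf_digraph) connected_iff_cut:
  "connected G \<longleftrightarrow> verts G \<noteq> {} \<and>
     (\<forall>A. A \<subset> verts G \<and> A \<noteq> {} \<longrightarrow> (\<exists>a \<in> A. \<exists>b \<in> verts G - A. a \<rightarrow>\<^bsub>G\<^esub> b \<or> b \<rightarrow>\<^bsub>G\<^esub> a))"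
proof -
  have "wf_digraph (with_proj (mk_symmetric G))"
    by unfold_locales (auto simp: mk_symmetric_def)
  moreover have "a \<rightarrow>\<^bsub>with_proj (mk_symmetric G)\<^esub> b \<longleftrightarrow> a \<rightarrow>\<^bsub>G\<^esub> b \<or> b \<rightarrow>\<^bsub>G\<^esub> a" for a b
    by (auto simp: mk_symmetric_def arcs_ends_conv)
  moreover have "pverts (mk_symmetric G) = verts G" by (simp add: mk_symmetric_def)
  ultimately show ?thesis
    by (simp add: connected_def wf_digraph.strongly_connected_iff_cut)
qed

lemma k_connected_mono: "k_connected m G \<Longrightarrow> l \<le> m \<Longrightarrow> k_connected l G"
  by (auto simp: k_connected_def intro: le_trans)

lemma strongly_k_connected_mono: "strongly_k_connected m G \<Longrightarrow> l \<le> m \<Longrightarrow> strongly_k_connected l G"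
  by (auto simp: strongly_k_connected_def intro: le_trans)

section \<open>Strongly connected Cayley digraphs\<close>

text \<open>Pulling the multiplication back along the isomorphism places a semigroup on the vertices
  of \<open>G\<close> itself, so that \<open>G\<close> equals a Cayley digraph and algebra can be
  done with its own vertices.\<close>

lemma semigroup_digraph_imp_Cay:
  assumes "semigroup_digraph G"
  obtains mul C where "fin_semigroup (pverts G) mul" "C \<subseteq> pverts G" "G = Cay (pverts G) mul C"
proof -
  obtain S :: "nat set" and mul C where sg: "fin_semigroup S mul" and C: "C \<subseteq> S"
    and iso: "digraph_iso (with_proj G) (with_proj (Cay S mul C))"
    using assms by (auto simp: semigroup_digraph_def)
  interpret fin_semigroup S mul by fact
  obtain h where h: "pre_digraph.digraph_isomorphism (with_proj G) h"
    and eq: "with_proj (Cay S mul C) = app_iso h (with_proj G)"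
    using iso by (auto simp: digraph_iso_def)
  define f where "f = iso_verts h"
  have wf: "pair_wf_digraph G" and inj: "inj_on f (pverts G)"
    using h by (simp_all add: pre_digraph.digraph_isomorphism_def f_def wf_digraph_wp_iff)
  interpret G: pair_wf_digraph G by (rule wf)
  have S: "f ` pverts G = S"
    using arg_cong[OF eq, of verts] by (simp add: f_def Cay_def)
  \<comment> \<open>Tails and heads are the projections on both sides, so the isomorphism acts on an
    arc through its action on the two end vertices.\<close>
  have "iso_tail h = fst" "iso_head h = snd"
    using arg_cong[OF eq, of tail] arg_cong[OF eq, of head] by simp_all
  then have "iso_arcs h e = map_prod f f e" if "e \<in> parcs G" for e
    using h that by (auto simp: pre_digraph.digraph_isomorphism_def f_def prod_eq_iff)
  then have arcs: "parcs (Cay S mul C) = map_prod f f ` parcs G"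
    using arg_cong[OF eq, of arcs] by simp
  define g where "g = the_inv_into (pverts G) f"
  have gf: "g (f x) = x" if "x \<in> pverts G" for x
    unfolding g_def using the_inv_into_f_f[OF inj that] .
  have fg: "f (g s) = s" "g s \<in> pverts G" if "s \<in> S" for s
    using that S gf by auto
  have fS: "f x \<in> S" if "x \<in> pverts G" for x using that S by blast
  define m where "m x y = g (mul (f x) (f y))" for x y
  have "fin_semigroup (pverts G) m"
  proof
    show "finite (pverts G)" using inj S finite_carrier finite_imageD by blast
    show "pverts G \<noteq> {}" using S nonempty_carrier by blast
  qed (simp_all add: m_def fg fS closed assoc)
  moreover have "g ` C \<subseteq> pverts G" using C fg by blast
  moreover have "parcs G = {(s, m s c) |s c. s \<in> pverts G \<and> c \<in> g ` C}"
  proof (intro equalityI subrelI)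
    fix x y assume xy: "(x, y) \<in> parcs G"
    then have "(f x, f y) \<in> parcs (Cay S mul C)" using arcs by force
    then obtain c where c: "c \<in> C" "f y = mul (f x) c" by (auto simp: Cay_def)
    have "m x (g c) = g (f y)" using c C fg(1)[of c] by (auto simp: m_def)
    also have "\<dots> = y" using xy by (intro gf) (rule G.in_arcsD2)
    finally show "(x, y) \<in> {(s, m s c) |s c. s \<in> pverts G \<and> c \<in> g ` C}"
      using G.in_arcsD1[OF xy] c(1) by blast
  next
    fix x y assume "(x, y) \<in> {(s, m s c) |s c. s \<in> pverts G \<and> c \<in> g ` C}"
    then obtain c where c: "x \<in> pverts G" "c \<in> C" "y = m x (g c)" by auto
    then have y: "y = g (mul (f x) c)" using C fg(1)[of c] by (auto simp: m_def)
    have "(f x, mul (f x) c) \<in> map_prod f f ` parcs G"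
      using c fS arcs[symmetric] by (auto simp: Cay_def)
    then obtain u w where uw: "(u, w) \<in> parcs G" "f x = f u" "mul (f x) c = f w" by auto
    moreover from this have "x = u" using c(1) inj G.in_arcsD1[of u w] by (auto dest: inj_onD)
    ultimately show "(x, y) \<in> parcs G" using y gf G.in_arcsD2[of u w] by simp
  qed
  ultimately show thesis
    by (intro that[of m "g ` C"]) (simp_all add: Cay_def)
qed

context fin_semigroup
begin

context
  fixes C
  assumes C: "C \<subseteq> S" and sc: "strongly_connected (with_proj (Cay S (\<cdot>) C))"
begin

lemma wf_Cay: "wf_digraph (with_proj (Cay S (\<cdot>) C))"
  using C by unfold_locales (auto simp: Cay_def closed subset_iff)

text \<open>No arc leaves a set closed under right multiplication by \<open>C\<close>. This is how
  strong connectivity enters the algebra.\<close>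

lemma right_mult_closed_imp_eq:
  assumes A: "A \<subseteq> S" "A \<noteq> {}" and closed: "\<And>a c. a \<in> A \<Longrightarrow> c \<in> C \<Longrightarrow> a \<cdot> c \<in> A"
  shows "A = S"
proof (rule ccontr)
  assume "A \<noteq> S"
  with A have "A \<subset> verts (with_proj (Cay S (\<cdot>) C)) \<and> A \<noteq> {}" by (auto simp: Cay_def)
  then have "\<exists>a \<in> A. \<exists>b \<in> verts (with_proj (Cay S (\<cdot>) C)) - A. a \<rightarrow>\<^bsub>with_proj (Cay S (\<cdot>) C)\<^esub> b"
    using iffD1[OF wf_digraph.strongly_connected_iff_cut[OF wf_Cay] sc] by blast
  then show False using closed by (auto simp: Cay_def)
qed

text \<open>By associativity, the left translate of \<open>S\<close> by \<open>s\<close> is closed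
  under right multiplication by \<open>C\<close>.\<close>

lemma image_left_mult:
  assumes s: "s \<in> S"
  shows "(\<cdot>) s ` S = S"
proof (rule right_mult_closed_imp_eq)
  fix a c assume "a \<in> (\<cdot>) s ` S" "c \<in> C"
  then obtain t where "t \<in> S" "a = s \<cdot> t" "c \<in> S" using C by blast
  then have "a \<cdot> c = s \<cdot> (t \<cdot> c)" "t \<cdot> c \<in> S" using s assoc closed by auto
  then show "a \<cdot> c \<in> (\<cdot>) s ` S" by blast
qed (use s closed nonempty_carrier in auto)

text \<open>Left multiplication by \<open>s\<close> maps the finite set \<open>S\<close> onto
  itself, hence is injective, so distinct elements of \<open>C\<close> give distinct out-neighbours
  of \<open>s\<close>.\<close>

lemma card_out_neighbours_Cay:
  assumes "s \<in> S"
  shows "card {t. (s, t) \<in> parcs (Cay S (\<cdot>) C)} = card C"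
proof -
  have "inj_on ((\<cdot>) s) S"
    using image_left_mult[OF assms] finite_carrier by (simp add: eq_card_imp_inj_on)
  then have "inj_on ((\<cdot>) s) C" using C by (rule inj_on_subset)
  moreover have "{t. (s, t) \<in> parcs (Cay S (\<cdot>) C)} = (\<cdot>) s ` C"
    using assms by (auto simp: Cay_def)
  ultimately show ?thesis by (simp add: card_image)
qed

text \<open>The conclusion forces \<open>S\<close> to be \<open>{v}\<close>. Left multiplications
  carry loops to loops and so fix \<open>v\<close>; this makes the semigroup right zero, and then
  the out-neighbours of every vertex are exactly the elements of \<open>C\<close>.\<close>

lemma unique_loop_imp_all_loops:
  assumes loop: "\<And>u. (u, u) \<in> parcs (Cay S (\<cdot>) C) \<longleftrightarrow> u = v" and u: "u \<in> S"
  shows "u = v"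
proof -
  obtain c where v: "v \<in> S" and c: "c \<in> C" "v \<cdot> c = v"
    using loop[of v] by (auto simp: Cay_def)
  have fixed: "s \<cdot> v = v" if s: "s \<in> S" for s
  proof -
    have "s \<cdot> v \<cdot> c = s \<cdot> v" using s v c C assoc[of s v c] by auto
    then have "(s \<cdot> v, s \<cdot> v) \<in> parcs (Cay S (\<cdot>) C)"
      using s v c closed by (force simp: Cay_def)
    then show ?thesis using loop by blast
  qed
  \<comment> \<open>Every \<open>t\<close> has the form \<open>v \<cdot> r\<close>, and
    \<open>v\<close> absorbs \<open>s\<close> on its left.\<close>
  have right_zero: "s \<cdot> t = t" if s: "s \<in> S" and t: "t \<in> S" for s t
  proof -
    obtain r where "r \<in> S" "t = v \<cdot> r" using image_left_mult[OF v] t by blast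
    then show ?thesis using s v fixed assoc[of s v r] by simp
  qed
  show ?thesis
  proof (rule ccontr)
    assume "u \<noteq> v"
    \<comment> \<open>All arcs end in \<open>C\<close>, so a \<open>u\<close> outside
      \<open>C\<close> would have no in-arc and its nonempty complement would be closed. Once
      \<open>u\<close> is in \<open>C\<close>, the product \<open>u \<cdot> u = u\<close> is a
      second loop.\<close>
    have "u \<in> C"
    proof (rule ccontr)
      assume "u \<notin> C"
      have "a \<cdot> c \<in> S - {u}" if "a \<in> S - {u}" "c \<in> C" for a c
      proof -
        have "a \<cdot> c = c" using that C by (auto intro: right_zero)
        then show ?thesis using that C \<open>u \<notin> C\<close> by auto
      qed
      then have "S - {u} = S"
        using v \<open>u \<noteq> v\<close> by (intro right_mult_closed_imp_eq) auto
      with u show False by blast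
    qed
    then have "(u, u) \<in> parcs (Cay S (\<cdot>) C)" using u right_zero by (force simp: Cay_def)
    with loop \<open>u \<noteq> v\<close> show False by blast
  qed
qed

end

end

section \<open>Gaps in the cyclic order\<close>

text \<open>A shortest forward step from \<open>A\<close> to \<open>B\<close> has no point of
  \<open>A\<close> or \<open>B\<close> in its interior, since such a point would start or end a
  shorter step.\<close>

lemma cyclic_gap:
  fixes n :: nat
  assumes A: "A \<subseteq> {..<n}" "A \<noteq> {}" and B: "B \<subseteq> {..<n}" "B \<noteq> {}" and disj: "A \<inter> B = {}"
  obtains a d where "a \<in> A" "0 < d" "d \<le> n" "(a + d) mod n \<in> B"
    "\<And>i. 0 < i \<Longrightarrow> i < d \<Longrightarrow> (a + i) mod n \<notin> A \<union> B"
proof -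
  define P where "P d \<longleftrightarrow> 0 < d \<and> (\<exists>a \<in> A. (a + d) mod n \<in> B)" for d
  obtain a0 b0 where "a0 \<in> A" "b0 \<in> B" using A B by blast
  moreover from this have "a0 < n" "b0 < n" using A B by auto
  \<comment> \<open>Passing \<open>n\<close> once keeps the step from \<open>a0\<close> to
    \<open>b0\<close> positive even if \<open>b0 < a0\<close>, so there is a step to minimise
    over.\<close>
  moreover from this have "(a0 + (n - a0 + b0)) mod n = b0" by simp
  ultimately have "0 < n - a0 + b0" "\<exists>a \<in> A. (a + (n - a0 + b0)) mod n \<in> B"
    by (auto intro!: bexI[of _ a0] simp del: add_diff_assoc add_diff_assoc2)
  then have "P (n - a0 + b0)" unfolding P_def by blast
  then have P: "P (LEAST d. P d)" by (rule LeastI)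
  define d where "d = (LEAST d. P d)"
  have min: "\<not> P i" if "i < d" for i using that not_less_Least unfolding d_def by blast
  obtain a where a: "0 < d" "a \<in> A" "(a + d) mod n \<in> B" using P by (auto simp: P_def d_def)
  show thesis
  proof (rule that[of a d])
    show "d \<le> n"
    proof (rule ccontr)
      assume "\<not> d \<le> n"
      \<comment> \<open>A step longer than \<open>n\<close> can be shortened by a full turn.\<close>
      then have "(a + (d - n)) mod n = (a + d) mod n" by (simp add: mod_if)
      then have "P (d - n)" using a \<open>\<not> d \<le> n\<close> unfolding P_def by (metis not_le zero_less_diff)
      moreover have "d - n < d" using \<open>a \<in> A\<close> A \<open>0 < d\<close> by fastforce
      ultimately show False using min by blast
    qed
    fix i assume i: "0 < i" "i < d"
    have "(a + i) mod n \<notin> B" using min[OF i(2)] i(1) a(2) by (auto simp: P_def)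
    moreover have "(a + i) mod n \<notin> A"
    proof
      assume "(a + i) mod n \<in> A"
      moreover have "((a + i) mod n + (d - i)) mod n = (a + d) mod n"
        by (subst mod_add_left_eq) (use i in simp)
      ultimately have "P (d - i)" using a i unfolding P_def by (metis zero_less_diff)
      then show False using min[of "d - i"] i by simp
    qed
    ultimately show "(a + i) mod n \<notin> A \<union> B" by blast
  qed (use a in auto)
qed

lemma inj_on_add_mod:
  fixes n :: nat
  shows "inj_on (\<lambda>i. (a + i) mod n) {0<..n}"
proof (rule linorder_inj_onI')
  fix i j assume ij: "i \<in> {0<..n}" "j \<in> {0<..n}" "i < j"
  show "(a + i) mod n \<noteq> (a + j) mod n"
  proof
    assume "(a + i) mod n = (a + j) mod n"
    then have "n dvd (a + j) - (a + i)" using ij(3) by (metis mod_eq_dvd_iff_nat add_left_mono less_imp_le)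
    then have "n dvd j - i" by simp
    with ij show False by (auto dest: dvd_imp_le)
  qed
qed

text \<open>The interiors of a shortest gap from \<open>A\<close> to \<open>B\<close> and of one
  from \<open>B\<close> to \<open>A\<close> are disjoint and avoid \<open>A\<close> and
  \<open>B\<close>. They have \<open>d - 1\<close> and \<open>e - 1\<close> points, whence the
  summand 2.\<close>

lemma two_cyclic_gaps:
  fixes n :: nat
  assumes A: "A \<subseteq> {..<n}" "A \<noteq> {}" and B: "B \<subseteq> {..<n}" "B \<noteq> {}" and disj: "A \<inter> B = {}"
  obtains a b d e where "a \<in> A" "0 < d" "(a + d) mod n \<in> B" "b \<in> B" "0 < e" "(b + e) mod n \<in> A"
    "d + e \<le> card ({..<n} - (A \<union> B)) + 2"
proof -
  obtain a d where ad: "a \<in> A" "0 < d" "d \<le> n" "(a + d) mod n \<in> B"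
    "\<And>i. 0 < i \<Longrightarrow> i < d \<Longrightarrow> (a + i) mod n \<notin> A \<union> B"
    using cyclic_gap[OF A B disj] by blast
  obtain b e where be: "b \<in> B" "0 < e" "e \<le> n" "(b + e) mod n \<in> A"
    "\<And>i. 0 < i \<Longrightarrow> i < e \<Longrightarrow> (b + i) mod n \<notin> B \<union> A"
    using cyclic_gap[OF B A] disj by (metis inf_commute)
  let ?I = "(\<lambda>i. (a + i) mod n) ` {0<..<d}" and ?J = "(\<lambda>i. (b + i) mod n) ` {0<..<e}"
  let ?X = "{..<n} - (A \<union> B)"
  have n: "0 < n" using A by force
  have "card ?I = d - 1" "card ?J = e - 1"
    using ad(3) be(3) by (auto intro!: card_image[THEN trans] inj_on_subset[OF inj_on_add_mod])
  moreover have "?I \<inter> ?J = {}"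
  proof (rule ccontr)
    assume "?I \<inter> ?J \<noteq> {}"
    then obtain i j where ij: "0 < i" "i < d" "0 < j" "j < e" "(a + i) mod n = (b + j) mod n"
      by auto
    have shift: "(a + (i + l)) mod n = (b + (j + l)) mod n" for l
      using ij(5) by (metis add.assoc mod_add_left_eq)
    \<comment> \<open>From a common interior point the gaps end after \<open>d - i\<close> and
      \<open>e - j\<close> further steps. The end reached first would lie in \<open>A\<close> or
      \<open>B\<close> but inside the other gap; a simultaneous end would lie in both sets.\<close>
    consider "d - i < e - j" | "d - i = e - j" | "e - j < d - i" by linarith
    then show False
    proof cases
      case 1
      have "(b + (j + (d - i))) mod n \<in> B" using shift[of "d - i"] ij(2) ad(4) by simp
      moreover have "(b + (j + (d - i))) mod n \<notin> B \<union> A"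
        using 1 ij by (intro be(5)) auto
      ultimately show False by blast
    next
      case 2
      then have "(a + (i + (d - i))) mod n = (b + (j + (e - j))) mod n" by (metis shift)
      then have "(a + d) mod n = (b + e) mod n" using ij(2,4) by simp
      with ad(4) be(4) disj show False by auto
    next
      case 3
      have "(a + (i + (e - j))) mod n \<in> A" using shift[of "e - j"] ij(4) be(4) by simp
      moreover have "(a + (i + (e - j))) mod n \<notin> A \<union> B"
        using 3 ij by (intro ad(5)) auto
      ultimately show False by blast
    qed
  qed
  moreover have "?I \<union> ?J \<subseteq> ?X" using ad(5) be(5) n by auto
  then have "card (?I \<union> ?J) \<le> card ?X" by (intro card_mono) auto
  ultimately have "(d - 1) + (e - 1) \<le> card ?X" by (simp add: card_Un_disjoint)
  then show thesis using that[of a d b e] ad be by simp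
qed

section \<open>A circulant digraph with one arc turned into a loop\<close>

text \<open>At 0 the jump \<open>k\<close> is traded for the jump 0, so the outdegree stays
  \<open>k\<close>.\<close>

definition jumps :: "nat \<Rightarrow> nat \<Rightarrow> nat set" where
  "jumps k i = (if i = 0 then {0..<k} else {0<..k})"

definition looped_circulant :: "nat \<Rightarrow> nat \<Rightarrow> nat pair_pre_digraph" where
  "looped_circulant k n =
     \<lparr> pverts = {..<n}, parcs = {(i, (i + j) mod n) | i j. i < n \<and> j \<in> jumps k i} \<rparr>"

context
  fixes k n :: nat
  assumes k: "1 < k" and n: "2 * k < n"
begin

abbreviation (input) "D \<equiv> looped_circulant k n"

lemma pverts_D [simp]: "pverts D = {..<n}"
  by (simp add: looped_circulant_def)

lemma D_arc_iff: "(u, v) \<in> parcs D \<longleftrightarrow> u < n \<and> (\<exists>j \<in> jumps k u. v = (u + j) mod n)"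
  by (auto simp: looped_circulant_def)

lemma pair_fin_digraph_D: "pair_fin_digraph D"
proof -
  have "parcs D \<subseteq> {..<n} \<times> {..<n}" using n by (auto simp: looped_circulant_def)
  then show ?thesis
    by unfold_locales (auto intro: finite_subset)
qed

lemma inj_on_jumps: "inj_on (\<lambda>j. (u + j) mod n) (jumps k u)"
proof (cases "u = 0")
  case True
  then show ?thesis using n by (auto simp: jumps_def inj_on_def)
next
  case False
  then show ?thesis using n by (auto simp: jumps_def intro: inj_on_subset[OF inj_on_add_mod])
qed

lemma card_out_neighbours_D:
  assumes "u < n"
  shows "card {v. (u, v) \<in> parcs D} = k"
proof -
  have "{v. (u, v) \<in> parcs D} = (\<lambda>j. (u + j) mod n) ` jumps k u"
    using assms by (auto simp: D_arc_iff)
  then show ?thesis by (simp add: card_image inj_on_jumps) (simp add: jumps_def)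
qed

lemma outregular_D: "outregular k (with_proj D)"
  unfolding outregular_def
proof
  fix u assume u: "u \<in> verts (with_proj D)"
  have "out_arcs (with_proj D) u = Pair u ` {v. (u, v) \<in> parcs D}"
    by (auto simp: out_arcs_def)
  then show "out_degree (with_proj D) u = k"
    using u by (simp add: out_degree_def card_image inj_on_def card_out_neighbours_D)
qed

lemma D_loop_iff: "(u, u) \<in> parcs D \<longleftrightarrow> u = 0"
proof
  assume "(u, u) \<in> parcs D"
  then obtain j where u: "u < n" and j: "j \<in> jumps k u" "u = (u + j) mod n"
    by (auto simp: D_arc_iff)
  show "u = 0"
  proof (rule ccontr)
    assume "u \<noteq> 0"
    then have "0 < j" "j < n" using j n by (auto simp: jumps_def)
    with u j(2) show False by (auto simp: mod_if split: if_splits)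
  qed
qed (use k n in \<open>auto simp: D_arc_iff jumps_def\<close>)

text \<open>The excluded case is exactly the arc that became a loop; all other arcs of the circulant
  digraph survive.\<close>

lemma D_arc:
  assumes "u < n" "0 < j" "j \<le> k" "\<not> (u = 0 \<and> j = k)"
  shows "(u, (u + j) mod n) \<in> parcs D"
  using assms by (auto simp: D_arc_iff jumps_def)

section \<open>Connectivity of the modified circulant digraph\<close>

lemma strongly_connected_D_diff:
  assumes X: "X \<subseteq> {..<n}" "card X < k - 1"
  shows "strongly_connected (with_proj D \<restriction> ({..<n} - X))"
proof -
  interpret pair_fin_digraph D by (rule pair_fin_digraph_D)
  let ?H = "with_proj D \<restriction> ({..<n} - X)"
  have wf: "wf_digraph ?H" by unfold_locales auto
  have "\<not> {..<n} \<subseteq> X"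
    using X n card_mono[OF finite_subset[OF X(1)], of "{..<n}"] by auto
  then have "{..<n} - X \<noteq> {}" by blast
  moreover have "\<exists>a \<in> A. \<exists>b \<in> {..<n} - X - A. a \<rightarrow>\<^bsub>?H\<^esub> b"
    if A: "A \<subset> {..<n} - X" "A \<noteq> {}" for A
  proof -
    let ?B = "{..<n} - X - A"
    obtain a d b e where "a \<in> A" "0 < d" "(a + d) mod n \<in> ?B" "b \<in> ?B" "0 < e"
      "(b + e) mod n \<in> A"
      and de: "d + e \<le> card ({..<n} - (A \<union> ?B)) + 2"
      by (rule two_cyclic_gaps[of A n ?B]) (use A in auto)
    moreover have "{..<n} - (A \<union> ?B) = X" using A X by auto
    \<comment> \<open>The bound on \<open>card X\<close> gives \<open>d + e \<le> k\<close>, and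
      \<open>e\<close> is positive. Positive jumps shorter than \<open>k\<close> exist at every
      vertex, including 0.\<close>
    ultimately have "d < k" using X(2) by simp
    then have "(a, (a + d) mod n) \<in> parcs D"
      using A \<open>a \<in> A\<close> \<open>0 < d\<close> by (intro D_arc) auto
    then have "a \<rightarrow>\<^bsub>?H\<^esub> ((a + d) mod n)"
      using A \<open>a \<in> A\<close> \<open>(a + d) mod n \<in> ?B\<close> by (force simp: arcs_ends_conv)
    then show ?thesis using \<open>a \<in> A\<close> \<open>(a + d) mod n \<in> ?B\<close> by blast
  qed
  ultimately show ?thesis by (simp add: wf_digraph.strongly_connected_iff_cut[OF wf])
qed

text \<open>Orientation no longer matters, so an arc across either of the two gaps suffices; this
  raises the bound to \<open>2 * k - 1\<close>.\<close>

lemma connected_underlying_D_diff: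
  assumes X: "X \<subseteq> {..<n}" "card X < 2 * k - 1"
  shows "connected (with_proj (underlying_graph D) \<restriction> ({..<n} - X))"
proof -
  interpret pair_fin_digraph D by (rule pair_fin_digraph_D)
  let ?H = "with_proj (underlying_graph D) \<restriction> ({..<n} - X)"
  have wf: "wf_digraph ?H" by unfold_locales auto
  have adj: "a \<rightarrow>\<^bsub>?H\<^esub> b"
    if "a \<in> {..<n} - X" "b \<in> {..<n} - X" "(a, b) \<in> parcs D" for a b
    using that by (force simp: arcs_ends_conv underlying_graph_def mk_symmetric_def)
  have "\<not> {..<n} \<subseteq> X"
    using X n card_mono[OF finite_subset[OF X(1)], of "{..<n}"] by auto
  then have "{..<n} - X \<noteq> {}" by blast
  moreover have "\<exists>a \<in> A. \<exists>b \<in> {..<n} - X - A. a \<rightarrow>\<^bsub>?H\<^esub> b \<or> b \<rightarrow>\<^bsub>?H\<^esub> a"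
    if A: "A \<subset> {..<n} - X" "A \<noteq> {}" for A
  proof -
    let ?B = "{..<n} - X - A"
    obtain a d b e where ab: "a \<in> A" "0 < d" "(a + d) mod n \<in> ?B" "b \<in> ?B" "0 < e" "(b + e) mod n \<in> A"
      and de: "d + e \<le> card ({..<n} - (A \<union> ?B)) + 2"
      by (rule two_cyclic_gaps[of A n ?B]) (use A in auto)
    moreover have "{..<n} - (A \<union> ?B) = X" using A X by auto
    ultimately have "d + e \<le> 2 * k" using X(2) by simp
    \<comment> \<open>Either one gap is shorter than \<open>k\<close>, or both equal
      \<open>k\<close>. In the latter case the removed arc can affect only one of them, as at most
      one of \<open>a\<close> and \<open>b\<close> is 0.\<close>
    moreover have "a \<noteq> b" using ab by auto
    ultimately have "d \<le> k \<and> \<not> (a = 0 \<and> d = k) \<or> e \<le> k \<and> \<not> (b = 0 \<and> e = k)" by auto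
    then show ?thesis
    proof
      assume "d \<le> k \<and> \<not> (a = 0 \<and> d = k)"
      then have "a \<rightarrow>\<^bsub>?H\<^esub> ((a + d) mod n)"
        using A ab by (intro adj D_arc) auto
      then show ?thesis using ab by blast
    next
      assume "e \<le> k \<and> \<not> (b = 0 \<and> e = k)"
      then have "b \<rightarrow>\<^bsub>?H\<^esub> ((b + e) mod n)"
        using A ab by (intro adj D_arc) auto
      then show ?thesis using ab by blast
    qed
  qed
  ultimately show ?thesis by (simp add: wf_digraph.connected_iff_cut[OF wf])
qed

lemma pverts_underlying_D [simp]: "pverts (underlying_graph D) = {..<n}"
  by (simp add: underlying_graph_def mk_symmetric_def)

lemma strongly_connected_D: "strongly_connected (with_proj D)"
proof -
  have "with_proj D \<restriction> {..<n} = with_proj D"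
    by (auto simp: induce_subgraph_def with_proj_def D_arc_iff)
  then show ?thesis using strongly_connected_D_diff[of "{}"] k by simp
qed

lemma strongly_k_connected_D: "strongly_k_connected (k - 1) (with_proj D)"
proof -
  have "k - 1 \<le> card X" if "directed_vertex_cut (with_proj D) X" for X
    using that strongly_connected_D_diff[of X] by (auto simp: directed_vertex_cut_def intro: leI)
  then show ?thesis
    using strongly_connected_D n by (simp add: strongly_k_connected_def)
qed

lemma k_connected_underlying_D: "k_connected (2 * k - 1) (with_proj (underlying_graph D))"
proof -
  have "with_proj (underlying_graph D) \<restriction> {..<n} = with_proj (underlying_graph D)"
    using n
    by (auto simp: induce_subgraph_def with_proj_def underlying_graph_def mk_symmetric_def D_arc_iff)
  then have "connected (with_proj (underlying_graph D))"
    using connected_underlying_D_diff[of "{}"] k by simp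
  moreover have "2 * k - 1 \<le> card X"
    if "vertex_cut (with_proj (underlying_graph D)) X" for X
    using that connected_underlying_D_diff[of X] by (auto simp: vertex_cut_def intro: leI)
  \<comment> \<open>The definition also asks for at least \<open>2 * k\<close> vertices, which
    \<open>2 * k < n\<close> provides.\<close>
  ultimately show ?thesis
    using n by (simp add: k_connected_def)
qed

section \<open>Adding loops does not produce a semigroup digraph\<close>

lemma strongly_connected_add_loops_D:
  assumes L: "L \<subseteq> {..<n}"
  shows "strongly_connected (with_proj (add_loops L D))"
proof -
  interpret pair_fin_digraph D by (rule pair_fin_digraph_D)
  have "wf_digraph (with_proj (add_loops L D))"
    using L in_arcsD1 in_arcsD2 by unfold_locales (auto simp: add_loops_def)
  moreover have "a \<rightarrow>\<^bsub>with_proj (add_loops L D)\<^esub> b" if "a \<rightarrow>\<^bsub>with_proj D\<^esub> b" for a b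
    using that by (simp add: add_loops_def)
  moreover have "verts (with_proj (add_loops L D)) = verts (with_proj D)"
    by (simp add: add_loops_def)
  ultimately show ?thesis
    using strongly_connected_D wf_digraph.strongly_connected_iff_cut wf_digraph_axioms
    by metis
qed

lemma not_semigroup_digraph_add_loops_D:
  assumes L: "L \<subseteq> {..<n}"
  shows "\<not> semigroup_digraph (add_loops L D)"
proof
  let ?D = "add_loops L D"
  have D': "pverts ?D = {..<n}" "(u, v) \<in> parcs ?D \<longleftrightarrow> (u, v) \<in> parcs D \<or> u = v \<and> u \<in> L" for u v
    by (auto simp: add_loops_def)
  assume "semigroup_digraph ?D"
  then obtain mul C where sg: "fin_semigroup {..<n} mul" and C: "C \<subseteq> {..<n}"
    and eq: "?D = Cay {..<n} mul C"
    using semigroup_digraph_imp_Cay D'(1) by metis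
  interpret fin_semigroup "{..<n}" mul by (rule sg)
  have sc: "strongly_connected (with_proj (Cay {..<n} mul C))"
    using strongly_connected_add_loops_D[OF L] eq by simp
  have outdeg: "card {v. (u, v) \<in> parcs ?D} = card C" if "u < n" for u
    using card_out_neighbours_Cay[OF C sc] that eq by simp
  \<comment> \<open>Vertex 0 already carries a loop, so its outdegree is still \<open>k\<close>;
    Cayley outregularity then fixes \<open>card C\<close>.\<close>
  have "{v. (0, v) \<in> parcs ?D} = {v. (0, v) \<in> parcs D}"
    using D_loop_iff by (auto simp: D')
  then have "card C = k" using outdeg[of 0] card_out_neighbours_D[of 0] n by simp
  \<comment> \<open>A new loop at a nonzero \<open>u\<close> would raise its outdegree to
    \<open>k + 1\<close>.\<close>
  have "u = 0" if u: "u \<in> L" for u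
  proof (rule ccontr)
    assume "u \<noteq> 0"
    have "{v. (u, v) \<in> parcs ?D} = insert u {v. (u, v) \<in> parcs D}"
      using u by (auto simp: D')
    moreover have "u \<notin> {v. (u, v) \<in> parcs D}" using \<open>u \<noteq> 0\<close> D_loop_iff by simp
    moreover have "u < n" using u L by auto
    moreover have "finite {v. (u, v) \<in> parcs D}"
      using card_out_neighbours_D[OF \<open>u < n\<close>] k by (intro card_ge_0_finite) simp
    ultimately show False
      using outdeg[of u] card_out_neighbours_D[of u] \<open>card C = k\<close> by simp
  qed
  then have "(u, u) \<in> parcs ?D \<longleftrightarrow> u = 0" for u
    using D_loop_iff by (auto simp: D')
  \<comment> \<open>With the only loop at 0, every vertex would have to be 0, but 1 is a vertex
    too.\<close>
  then have "(1 :: nat) = 0"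
    using unique_loop_imp_all_loops[OF C sc, of 0 1] eq k n by auto
  then show False by simp
qed

lemma not_semigroup_digraph_D: "\<not> semigroup_digraph D"
  using not_semigroup_digraph_add_loops_D[of "{}"] by (simp add: add_loops_def looped_circulant_def)

end

section \<open>Infinite families and the theorem\<close>

lemma digraph_iso_imp_card_verts_eq: "digraph_iso G H \<Longrightarrow> card (verts G) = card (verts H)"
  by (auto simp: digraph_iso_def pre_digraph.digraph_isomorphism_def card_image)

text \<open>The number of vertices is an isomorphism invariant, so members of different order are
  distinct and non-isomorphic.\<close>

lemma infinitely_many_digraphsI:
  assumes "\<And>n. m < n \<Longrightarrow> pair_fin_digraph (F n) \<and> card (pverts (F n)) = n \<and> P (F n)"
  shows "infinitely_many_digraphs P"
  unfolding infinitely_many_digraphs_def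
proof (intro exI conjI ballI)
  have "inj_on F {m<..}" using assms by (metis inj_onI greaterThan_iff)
  then show "infinite (F ` {m<..})" by (simp add: finite_image_iff infinite_Ioi)
  show "pairwise (\<lambda>G H. \<not> digraph_iso (with_proj G) (with_proj H)) (F ` {m<..})"
    using assms by (fastforce simp: pairwise_def dest: digraph_iso_imp_card_verts_eq)
  fix G assume "G \<in> F ` {m<..}"
  then obtain n where n: "m < n" "G = F n" by auto
  show "pair_fin_digraph G" "P G" using assms n by auto
  show "pverts G \<noteq> {}" using assms[OF n(1)] n by auto
qed

text \<open>One family serves all three claims of the theorem: \<open>\<kappa> < k\<close> yields
  \<open>\<kappa> \<le> k - 1\<close> and \<open>k + \<kappa> \<le> 2 * k - 1\<close>, the two
  connectivity bounds proved above.\<close>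

lemma infinitely_many_non_semigroup_digraphs:
  assumes "1 < k" "\<kappa> < k"
  shows "infinitely_many_digraphs (\<lambda>G.
    strongly_connected (with_proj G) \<and> outregular k (with_proj G) \<and>
    \<not> semigroup_digraph G \<and>
    strongly_k_connected \<kappa> (with_proj G) \<and>
    k_connected (k + \<kappa>) (with_proj (underlying_graph G)) \<and>
    (\<forall>L \<subseteq> pverts G. \<not> semigroup_digraph (add_loops L G)))"
proof (rule infinitely_many_digraphsI[of "2 * k" "looped_circulant k"])
  fix n assume n: "2 * k < n"
  have "strongly_k_connected \<kappa> (with_proj (looped_circulant k n))"
    using strongly_k_connected_D[OF assms(1) n] by (rule strongly_k_connected_mono) (use assms in simp)
  moreover have "k_connected (k + \<kappa>) (with_proj (underlying_graph (looped_circulant k n)))"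
    using k_connected_underlying_D[OF assms(1) n] by (rule k_connected_mono) (use assms in simp)
  ultimately show "pair_fin_digraph (looped_circulant k n) \<and> card (pverts (looped_circulant k n)) = n \<and>
    strongly_connected (with_proj (looped_circulant k n)) \<and>
    outregular k (with_proj (looped_circulant k n)) \<and>
    \<not> semigroup_digraph (looped_circulant k n) \<and>
    strongly_k_connected \<kappa> (with_proj (looped_circulant k n)) \<and>
    k_connected (k + \<kappa>) (with_proj (underlying_graph (looped_circulant k n))) \<and>
    (\<forall>L \<subseteq> pverts (looped_circulant k n). \<not> semigroup_digraph (add_loops L (looped_circulant k n)))"
    using n pair_fin_digraph_D[OF assms(1) n] strongly_connected_D[OF assms(1) n]
      outregular_D[OF assms(1) n] not_semigroup_digraph_D[OF assms(1) n]
      not_semigroup_digraph_add_loops_D[OF assms(1) n]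
    by (simp add: looped_circulant_def)
qed

lemma infinitely_many_digraphs_mono:
  assumes "infinitely_many_digraphs P" "\<And>G. P G \<Longrightarrow> Q G"
  shows "infinitely_many_digraphs Q"
  using assms unfolding infinitely_many_digraphs_def by metis

theorem theorem3p5:
  fixes k :: nat
  assumes "k > 1"
  shows "infinitely_many_digraphs (\<lambda>G.
           strongly_connected (with_proj G) \<and> outregular k (with_proj G) \<and>
           \<not> semigroup_digraph G) \<and>
         (\<forall>\<kappa>::nat. \<kappa> > 0 \<and> k div \<kappa> > 1 \<longrightarrow>
           infinitely_many_digraphs (\<lambda>G.
             strongly_connected (with_proj G) \<and> outregular k (with_proj G) \<and>
             \<not> semigroup_digraph G \<and>
             strongly_k_connected \<kappa> (with_proj G) \<and>
             k_connected (k + \<kappa>) (with_proj (underlying_graph G)))) \<and>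
         (\<forall>\<kappa>::nat. \<kappa> > 0 \<and> k div \<kappa> > 2 \<longrightarrow>
           infinitely_many_digraphs (\<lambda>G.
             strongly_connected (with_proj G) \<and> outregular k (with_proj G) \<and>
             \<not> semigroup_digraph G \<and>
             strongly_k_connected \<kappa> (with_proj G) \<and>
             k_connected (k + \<kappa>) (with_proj (underlying_graph G)) \<and>
             (\<forall>L \<subseteq> pverts G. \<not> semigroup_digraph (add_loops L G))))"
proof -
  have "\<kappa> < k" if "\<kappa> > 0" "k div \<kappa> > 1" for \<kappa>
  proof (rule ccontr)
    assume "\<not> \<kappa> < k"
    then have "k div \<kappa> \<le> \<kappa> div \<kappa>" by (intro div_le_mono) simp
    with that show False by simp
  qed
  \<comment> \<open>The alternative \<open>\<kappa> = 1\<close> serves the first claim, which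
    mentions no \<open>\<kappa>\<close>.\<close>
  then have "\<kappa> < k" if "\<kappa> > 0 \<and> k div \<kappa> > 1 \<or> \<kappa> = 1" for \<kappa>
    using that assms by blast
  note witnesses = infinitely_many_non_semigroup_digraphs[OF assms this]
  show ?thesis
  proof (intro conjI allI impI)
    show "infinitely_many_digraphs (\<lambda>G. strongly_connected (with_proj G) \<and>
        outregular k (with_proj G) \<and> \<not> semigroup_digraph G)"
      by (rule infinitely_many_digraphs_mono[OF witnesses[of 1]]) auto
  qed (rule infinitely_many_digraphs_mono[OF witnesses], auto)+
qed

end
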